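(* Let $n \ge 2$ be an integer and let $R_\infty = \mathbb{Z}[\{x_i\}_{i=1}^\infty]$ be the ring of polynomials with integer coefficients in countably many commuting indeterminates. Then $V(2^n) = v(2^n, R_\infty) = \infty$.
   Context: For a commutative ring $R$ with identity and a positive integer $k$, let $J(k,R)$ be the subring of $R$ generated by all $k$-th powers of elements of $R$. If there is an integer $v \ge 1$ such that every element $f \in J(k,R)$ can be written as $f = \sum_{i=1}^v \pm f_i^k$ for some $f_1,\ldots,f_v \in R$ and some choice of signs, let $v(k,R)$ be the smallest such $v$; if no such $v$ exists, set $v(k,R) = \infty$. Define $V(k)$ to be the supremum of $v(k,R)$ over all commutative rings $R$ with identity. *)

theory Defs
  imports
    "HOL-Algebra.Generated_Rings"
    "HOL-Algebra.Algebraic_Closure_Type"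
    "HOL-Library.Poly_Mapping"
    "HOL-Library.Extended_Nat"
begin

definition power_ring :: "nat \<Rightarrow> ('a, 'b) ring_scheme \<Rightarrow> 'a set"
  where "power_ring k R = generate_ring R {a [^]\<^bsub>R\<^esub> k | a. a \<in> carrier R}"

definition signed_power_sum :: "nat \<Rightarrow> ('a, 'b) ring_scheme \<Rightarrow> nat \<Rightarrow> 'a \<Rightarrow> bool"
  where "signed_power_sum k R m f \<longleftrightarrow>
    (\<exists>g \<in> {1..m} \<rightarrow> carrier R. \<exists>\<epsilon> \<in> {1..m} \<rightarrow> {\<one>\<^bsub>R\<^esub>, \<ominus>\<^bsub>R\<^esub> \<one>\<^bsub>R\<^esub>}.
       f = (\<Oplus>\<^bsub>R\<^esub>i\<in>{1..m}. \<epsilon> i \<otimes>\<^bsub>R\<^esub> g i [^]\<^bsub>R\<^esub> k))"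

definition waring_bound :: "nat \<Rightarrow> ('a, 'b) ring_scheme \<Rightarrow> nat \<Rightarrow> bool"
  where "waring_bound k R m \<longleftrightarrow> m \<ge> 1 \<and> (\<forall>f \<in> power_ring k R. signed_power_sum k R m f)"

definition waring_v :: "nat \<Rightarrow> ('a, 'b) ring_scheme \<Rightarrow> enat"
  where "waring_v k R =
    (if \<exists>m. waring_bound k R m then enat (LEAST m. waring_bound k R m) else \<infinity>)"

text \<open>
  HOL cannot quantify over all types inside a definition, so the supremum over all commutative
  rings is taken over those whose carrier is a subset of a given type \<open>'u\<close>.  By
  \<open>waring_v_le_waring_V\<close> below, for every infinite type \<open>'u\<close> this is an upper bound for
  \<open>waring_v k R\<close> for every commutative ring \<open>R\<close> over any type whatsoever (and it is the least
  one by definition), so for infinite \<open>'u\<close> it is the supremum over all commutative rings.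
\<close>

definition waring_V :: "'u itself \<Rightarrow> nat \<Rightarrow> enat"
  where "waring_V U k = (SUP R \<in> {R :: 'u ring. cring R}. waring_v k R)"

text \<open>
  The variables are indexed by \<open>nat\<close>: a monomial is a finitely supported exponent map
  \<open>nat \<Rightarrow>\<^sub>0 nat\<close>, and a polynomial is a finitely supported map from monomials to \<open>int\<close>.
\<close>

definition R_inf :: "((nat \<Rightarrow>\<^sub>0 nat) \<Rightarrow>\<^sub>0 int) ring"
  where "R_inf = ring_of_type_algebra"


lemma hom_nat_pow:
  assumes "cring R" "cring S" "h \<in> ring_hom R S" "x \<in> carrier R"
  shows "h (x [^]\<^bsub>R\<^esub> (k::nat)) = h x [^]\<^bsub>S\<^esub> k"
proof -
  interpret ring_hom_cring R S h
    using assms(1-3) by (rule UnivPoly.ring_hom_cringI)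
  show ?thesis using assms(4) by simp
qed

lemma power_ring_hom:
  assumes "cring R" "cring S" "h \<in> ring_hom R S" "f \<in> power_ring k R"
  shows "h f \<in> power_ring k S"
proof -
  interpret ring_hom_cring R S h
    using assms(1-3) by (rule UnivPoly.ring_hom_cringI)
  have sub: "{a [^]\<^bsub>R\<^esub> k | a. a \<in> carrier R} \<subseteq> carrier R" by auto
  show ?thesis using assms(4) unfolding power_ring_def
  proof (induction rule: generate_ring.induct)
    case one
    then show ?case by (simp add: generate_ring.one)
  next
    case (incl x)
    then obtain a where "a \<in> carrier R" "x = a [^]\<^bsub>R\<^esub> k" by blast
    then show ?case by (auto intro!: generate_ring.incl)
  next
    case (a_inv x)
    then show ?case
      using R.generate_ring_in_carrier[OF sub] by (simp add: generate_ring.a_inv)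
  next
    case (eng_add x y)
    then show ?case
      using R.generate_ring_in_carrier[OF sub] by (simp add: generate_ring.eng_add)
  next
    case (eng_mult x y)
    then show ?case
      using R.generate_ring_in_carrier[OF sub] by (simp add: generate_ring.eng_mult)
  qed
qed

lemma signed_power_sum_hom:
  assumes "cring R" "cring S" "h \<in> ring_hom R S" "signed_power_sum k R m f"
  shows "signed_power_sum k S m (h f)"
proof -
  interpret ring_hom_cring R S h
    using assms(1-3) by (rule UnivPoly.ring_hom_cringI)
  obtain g e where g: "g \<in> {1..m} \<rightarrow> carrier R" and e: "e \<in> {1..m} \<rightarrow> {\<one>\<^bsub>R\<^esub>, \<ominus>\<^bsub>R\<^esub> \<one>\<^bsub>R\<^esub>}"
    and f: "f = (\<Oplus>\<^bsub>R\<^esub>i\<in>{1..m}. e i \<otimes>\<^bsub>R\<^esub> g i [^]\<^bsub>R\<^esub> k)"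
    using assms(4) unfolding signed_power_sum_def by blast
  have ec: "e i \<in> carrier R" if "i \<in> {1..m}" for i
    using e that by (auto simp: Pi_iff dest!: bspec)
  have gc: "g i \<in> carrier R" if "i \<in> {1..m}" for i
    using g that by auto
  have "h f = (\<Oplus>\<^bsub>S\<^esub>i\<in>{1..m}. h (e i \<otimes>\<^bsub>R\<^esub> g i [^]\<^bsub>R\<^esub> k))"
    unfolding f using ec gc by (subst hom_finsum) (auto simp: o_def)
  also have "\<dots> = (\<Oplus>\<^bsub>S\<^esub>i\<in>{1..m}. h (e i) \<otimes>\<^bsub>S\<^esub> h (g i) [^]\<^bsub>S\<^esub> k)"
    using ec gc by (intro S.finsum_cong') auto
  finally have "h f = (\<Oplus>\<^bsub>S\<^esub>i\<in>{1..m}. h (e i) \<otimes>\<^bsub>S\<^esub> h (g i) [^]\<^bsub>S\<^esub> k)" .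
  moreover have "(\<lambda>i. h (g i)) \<in> {1..m} \<rightarrow> carrier S" using gc by auto
  moreover have "(\<lambda>i. h (e i)) \<in> {1..m} \<rightarrow> {\<one>\<^bsub>S\<^esub>, \<ominus>\<^bsub>S\<^esub> \<one>\<^bsub>S\<^esub>}"
  proof
    fix i assume "i \<in> {1..m}"
    then have "e i = \<one>\<^bsub>R\<^esub> \<or> e i = \<ominus>\<^bsub>R\<^esub> \<one>\<^bsub>R\<^esub>" using e by auto
    then show "h (e i) \<in> {\<one>\<^bsub>S\<^esub>, \<ominus>\<^bsub>S\<^esub> \<one>\<^bsub>S\<^esub>}" by auto
  qed
  ultimately show ?thesis unfolding signed_power_sum_def
    by (intro bexI[of _ "\<lambda>i. h (g i)"] bexI[of _ "\<lambda>i. h (e i)"])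
qed

lemma signed_power_sum_Suc:
  assumes "cring R" "k \<ge> 1" "signed_power_sum k R m f"
  shows "signed_power_sum k R (Suc m) f"
proof -
  interpret cring R by fact
  obtain g e where g: "g \<in> {1..m} \<rightarrow> carrier R" and e: "e \<in> {1..m} \<rightarrow> {\<one>\<^bsub>R\<^esub>, \<ominus>\<^bsub>R\<^esub> \<one>\<^bsub>R\<^esub>}"
    and f: "f = (\<Oplus>\<^bsub>R\<^esub>i\<in>{1..m}. e i \<otimes>\<^bsub>R\<^esub> g i [^]\<^bsub>R\<^esub> k)"
    using assms(3) unfolding signed_power_sum_def by blast
  have ec: "e i \<in> carrier R" if "i \<in> {1..m}" for i
    using e that by (auto simp: Pi_iff dest!: bspec)
  have gc: "g i \<in> carrier R" if "i \<in> {1..m}" for i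
    using g that by auto
  define g' where "g' = g(Suc m := \<zero>\<^bsub>R\<^esub>)"
  define e' where "e' = e(Suc m := \<one>\<^bsub>R\<^esub>)"
  have ins: "{1..Suc m} = insert (Suc m) {1..m}" by auto
  have fc: "f \<in> carrier R" unfolding f using ec gc by (intro finsum_closed) auto
  have same: "(\<Oplus>\<^bsub>R\<^esub>i\<in>{1..m}. e' i \<otimes>\<^bsub>R\<^esub> g' i [^]\<^bsub>R\<^esub> k) = f"
    unfolding f by (intro finsum_cong') (use ec gc in \<open>auto simp: g'_def e'_def\<close>)
  have g': "g' \<in> {1..Suc m} \<rightarrow> carrier R" and e': "e' \<in> {1..Suc m} \<rightarrow> {\<one>\<^bsub>R\<^esub>, \<ominus>\<^bsub>R\<^esub> \<one>\<^bsub>R\<^esub>}"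
    unfolding ins using g e by (auto simp: g'_def e'_def)
  have "(\<Oplus>\<^bsub>R\<^esub>i\<in>{1..Suc m}. e' i \<otimes>\<^bsub>R\<^esub> g' i [^]\<^bsub>R\<^esub> k) =
      e' (Suc m) \<otimes>\<^bsub>R\<^esub> g' (Suc m) [^]\<^bsub>R\<^esub> k \<oplus>\<^bsub>R\<^esub> (\<Oplus>\<^bsub>R\<^esub>i\<in>{1..m}. e' i \<otimes>\<^bsub>R\<^esub> g' i [^]\<^bsub>R\<^esub> k)"
    unfolding ins by (subst finsum_insert) (use ec gc in \<open>auto simp: g'_def e'_def\<close>)
  also have "\<dots> = f"
    unfolding same using fc assms(2) by (simp add: g'_def e'_def nat_pow_zero)
  finally show ?thesis unfolding signed_power_sum_def
    by (intro bexI[OF _ g'] bexI[OF _ e']) simp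
qed

lemma signed_power_sum_mono:
  assumes "cring R" "k \<ge> 1" "m \<le> m'" "signed_power_sum k R m f"
  shows "signed_power_sum k R m' f"
  using assms(3)
proof (induction m' rule: dec_induct)
  case base
  show ?case by fact
next
  case (step i)
  show ?case by (rule signed_power_sum_Suc[OF assms(1,2) step.IH])
qed

lemma waring_v_le_iff:
  assumes "cring R" "k \<ge> 1"
  shows "waring_v k R \<le> enat m \<longleftrightarrow> waring_bound k R m"
proof
  assume le: "waring_v k R \<le> enat m"
  then have ex: "\<exists>m. waring_bound k R m" by (auto simp: waring_v_def split: if_splits)
  then have "waring_bound k R (LEAST m. waring_bound k R m)" by (rule LeastI_ex)
  moreover have "(LEAST m. waring_bound k R m) \<le> m" using le ex by (simp add: waring_v_def)
  ultimately show "waring_bound k R m"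
    unfolding waring_bound_def using signed_power_sum_mono[OF assms] by (meson le_trans)
next
  assume "waring_bound k R m"
  then show "waring_v k R \<le> enat m" by (auto simp: waring_v_def intro: Least_le)
qed

lemma countable_generate_ring:
  assumes "countable H"
  shows "countable (generate_ring R H)"
proof -
  define step where "step A = A \<union> (\<lambda>x. \<ominus>\<^bsub>R\<^esub> x) ` A \<union> (\<lambda>(x, y). x \<oplus>\<^bsub>R\<^esub> y) ` (A \<times> A)
      \<union> (\<lambda>(x, y). x \<otimes>\<^bsub>R\<^esub> y) ` (A \<times> A)" for A
  define A where "A n = (step ^^ n) (insert \<one>\<^bsub>R\<^esub> H)" for n
  have A_Suc: "A (Suc n) = step (A n)" for n by (simp add: A_def)
  have cnt: "countable (A n)" for n
    by (induction n) (auto simp: A_Suc, auto simp: A_def step_def assms)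
  have mono: "A i \<subseteq> A j" if "i \<le> j" for i j
    using that by (rule lift_Suc_mono_le[rotated]) (auto simp: A_Suc step_def)
  have "x \<in> (\<Union>n. A n)" if "x \<in> generate_ring R H" for x
    using that
  proof (induction rule: generate_ring.induct)
    case one
    have "\<one>\<^bsub>R\<^esub> \<in> A 0" by (simp add: A_def)
    then show ?case by blast
  next
    case (incl h)
    then have "h \<in> A 0" by (simp add: A_def)
    then show ?case by blast
  next
    case (a_inv h)
    then obtain i where "h \<in> A i" by blast
    then have "\<ominus>\<^bsub>R\<^esub> h \<in> A (Suc i)" by (auto simp: A_Suc step_def)
    then show ?case by blast
  next
    case (eng_add x y)
    then obtain i j where "x \<in> A i" "y \<in> A j" by blast
    then have "x \<in> A (max i j)" "y \<in> A (max i j)"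
      using mono[of i "max i j"] mono[of j "max i j"] by auto
    then have "x \<oplus>\<^bsub>R\<^esub> y \<in> A (Suc (max i j))" by (force simp: A_Suc step_def)
    then show ?case by blast
  next
    case (eng_mult x y)
    then obtain i j where "x \<in> A i" "y \<in> A j" by blast
    then have "x \<in> A (max i j)" "y \<in> A (max i j)"
      using mono[of i "max i j"] mono[of j "max i j"] by auto
    then have "x \<otimes>\<^bsub>R\<^esub> y \<in> A (Suc (max i j))" by (force simp: A_Suc step_def)
    then show ?case by blast
  qed
  then have "generate_ring R H \<subseteq> (\<Union>n. A n)" by blast
  then show ?thesis using cnt by (meson countable_UN countable_subset countableI_type)
qed

lemma power_ring_finite_support:
  assumes "cring R" "f \<in> power_ring k R"
  shows "\<exists>F. finite F \<and> F \<subseteq> carrier R \<and> f \<in> generate_ring R {a [^]\<^bsub>R\<^esub> k | a. a \<in> F}"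
proof -
  interpret cring R by fact
  define G where "G F = generate_ring R {a [^]\<^bsub>R\<^esub> k | a. a \<in> F}" for F
  have mono: "G F \<subseteq> G F'" if "F \<subseteq> F'" "F' \<subseteq> carrier R" for F F'
    unfolding G_def using that by (intro mono_generate_ring) auto
  have comb: "\<exists>F. finite F \<and> F \<subseteq> carrier R \<and> x \<in> G F \<and> y \<in> G F"
    if x: "\<exists>F. finite F \<and> F \<subseteq> carrier R \<and> x \<in> G F"
      and y: "\<exists>F. finite F \<and> F \<subseteq> carrier R \<and> y \<in> G F" for x y
  proof -
    from x obtain F where F: "finite F" "F \<subseteq> carrier R" "x \<in> G F" by (elim exE conjE)
    from y obtain F' where F': "finite F'" "F' \<subseteq> carrier R" "y \<in> G F'" by (elim exE conjE)
    have "F \<union> F' \<subseteq> carrier R" using F F' by simp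
    with mono[of F "F \<union> F'"] mono[of F' "F \<union> F'"] F F' show ?thesis
      by (intro exI[of _ "F \<union> F'"] conjI) auto
  qed
  have "\<exists>F. finite F \<and> F \<subseteq> carrier R \<and> f \<in> G F"
    using assms(2) unfolding power_ring_def
  proof (induction rule: generate_ring.induct)
    case one
    show ?case by (intro exI[of _ "{}"]) (simp add: G_def generate_ring.one)
  next
    case (incl h)
    then obtain a where a: "a \<in> carrier R" "h = a [^]\<^bsub>R\<^esub> k" by auto
    then have "h \<in> G {a}" unfolding G_def by (intro generate_ring.incl) simp
    with a show ?case by (intro exI[of _ "{a}"]) simp
  next
    case (a_inv h)
    have "\<ominus>\<^bsub>R\<^esub> h \<in> G F" if "h \<in> G F" for F
      using that unfolding G_def by (rule generate_ring.a_inv)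
    with a_inv.IH show ?case by auto
  next
    case (eng_add x y)
    have "x \<oplus>\<^bsub>R\<^esub> y \<in> G F" if "x \<in> G F" "y \<in> G F" for F
      using that unfolding G_def by (rule generate_ring.eng_add)
    with comb[OF eng_add.IH] show ?case by auto
  next
    case (eng_mult x y)
    have "x \<otimes>\<^bsub>R\<^esub> y \<in> G F" if "x \<in> G F" "y \<in> G F" for F
      using that unfolding G_def by (rule generate_ring.eng_mult)
    with comb[OF eng_mult.IH] show ?case by auto
  qed
  then show ?thesis unfolding G_def .
qed

lemma waring_v_le_waring_V:
  fixes R :: "('a, 'b) ring_scheme"
  assumes R: "cring R" and k: "k \<ge> 1" and inf: "infinite (UNIV :: 'u set)"
  shows "waring_v k R \<le> waring_V TYPE('u) k"
proof (cases "waring_V TYPE('u) k")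
  case (enat m)
  interpret cring R by fact
  have bound: "waring_bound k T m" if "cring T" for T :: "'u ring"
  proof -
    have "waring_v k T \<le> enat m"
      unfolding enat[symmetric] waring_V_def using that by (intro SUP_upper) auto
    then show ?thesis using waring_v_le_iff[OF that k] by simp
  qed
  have main: "m \<ge> 1 \<and> signed_power_sum k R m f" if f: "f \<in> power_ring k R" for f
  proof -
    obtain F where F: "finite F" "F \<subseteq> carrier R"
        "f \<in> generate_ring R {a [^]\<^bsub>R\<^esub> k | a. a \<in> F}"
      using power_ring_finite_support[OF R f] by (elim exE conjE)
    define S where "S = generate_ring R F"
    define RS where "RS = R\<lparr>carrier := S\<rparr>"
    have subS: "subring S R" unfolding S_def by (rule generate_ring_is_subring[OF F(2)])
    have cS: "S \<subseteq> carrier R" using subringE(1)[OF subS] .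
    have "subcring S R"
      using subS by (intro subcringI) (use cS m_comm in blast)+
    then have RS: "cring RS" unfolding RS_def using subcring_iff[OF cS] by simp
    have pow: "a [^]\<^bsub>RS\<^esub> k = a [^]\<^bsub>R\<^esub> k" for a
      unfolding RS_def nat_pow_def by simp
    have FS: "F \<subseteq> S" unfolding S_def by (auto intro: generate_ring.incl)
    interpret RS: cring RS by fact
    have powS: "{a [^]\<^bsub>R\<^esub> k | a. a \<in> S} \<subseteq> S"
    proof -
      have "a [^]\<^bsub>RS\<^esub> k \<in> carrier RS" if "a \<in> S" for a
        using that by (intro RS.nat_pow_closed) (simp add: RS_def)
      then show ?thesis unfolding pow by (auto simp: RS_def)
    qed
    have "generate_ring R {a [^]\<^bsub>R\<^esub> k | a. a \<in> F} \<subseteq> generate_ring R {a [^]\<^bsub>R\<^esub> k | a. a \<in> S}"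
      using FS cS by (intro mono_generate_ring) auto
    also have "\<dots> = generate_ring RS {a [^]\<^bsub>R\<^esub> k | a. a \<in> S}"
      unfolding RS_def by (rule subring_gen_equality[OF subS powS])
    also have "\<dots> = power_ring k RS"
      unfolding power_ring_def pow by (simp add: RS_def)
    finally have fS: "f \<in> power_ring k RS" using F(3) by blast
    have cntS: "countable S"
      unfolding S_def using F(1) by (intro countable_generate_ring countable_finite)
    obtain p :: "nat \<Rightarrow> 'u" where p: "inj p"
      using infinite_countable_subset[OF inf] by blast
    define \<phi> where "\<phi> = p \<circ> to_nat_on S"
    have inj: "inj_on \<phi> S"
      unfolding \<phi>_def using cntS p by (intro comp_inj_on) (auto intro: inj_on_subset)
    define T where "T = image_ring \<phi> RS"
    have iso: "\<phi> \<in> ring_iso RS T"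
      unfolding T_def by (rule inj_imp_image_ring_iso) (simp add: RS_def inj)
    have "cring (T\<lparr>zero := \<phi> \<zero>\<^bsub>RS\<^esub>\<rparr>)"
      by (rule RS.ring_iso_imp_img_cring[OF iso])
    moreover have "T\<lparr>zero := \<phi> \<zero>\<^bsub>RS\<^esub>\<rparr> = T"
      unfolding T_def by (simp add: image_ring_def image_group_def monoid.defs)
    ultimately have T: "cring T" by simp
    have hom: "\<phi> \<in> ring_hom RS T" using iso by (simp add: ring_iso_def)
    have "inv_into (carrier RS) \<phi> \<in> ring_hom T RS"
      using ring_iso_set_sym[OF RS.ring_axioms iso] by (simp add: ring_iso_def)
    then have hom': "inv_into S \<phi> \<in> ring_hom T R"
      unfolding ring_hom_def RS_def using cS by auto
    have "{a [^]\<^bsub>RS\<^esub> k | a. a \<in> carrier RS} \<subseteq> carrier RS" by auto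
    from RS.generate_ring_in_carrier[OF this] have fS': "f \<in> S"
      using fS unfolding power_ring_def by (simp add: RS_def)
    have "signed_power_sum k T m (\<phi> f)"
      using bound[OF T] power_ring_hom[OF RS T hom fS] unfolding waring_bound_def by blast
    from signed_power_sum_hom[OF T R hom' this] have "signed_power_sum k R m f"
      using inv_into_f_f[OF inj fS'] by simp
    then show ?thesis using bound[OF T] by (simp add: waring_bound_def)
  qed
  have "\<one>\<^bsub>R\<^esub> \<in> power_ring k R" unfolding power_ring_def by (rule generate_ring.one)
  from main[OF this] have "m \<ge> 1" by blast
  then have "waring_bound k R m" unfolding waring_bound_def using main by blast
  then show ?thesis unfolding enat using waring_v_le_iff[OF R k] by simp
qed simp

end

theory Submission
  imports Defs
begin

text \<open>
  Write \<open>k = 2 ^ n\<close> and fix two distinct variables \<open>u, v\<close>. Let \<open>a, c, d\<close> be the coefficients of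
  \<open>1, u, v\<close> in \<open>f\<close>. To a polynomial \<open>h\<close> we attach the integer
  \<open>[u v] h + (k / 2) [(u v) ^ (k / 2)] h\<close>; it depends additively on \<open>h\<close>, and for \<open>h = f ^ k\<close> it is
  congruent to \<open>k (1 + a) c d\<close> modulo \<open>2 k\<close>: since \<open>n \<ge> 2\<close>, the second coefficient is
  congruent modulo 4 to the coefficient of \<open>u v\<close> in \<open>f ^ 2\<close>, which cancels the contribution of the
  coefficient of \<open>u v\<close> in \<open>f\<close>.

  Suppose the sum of \<open>(x\<^sub>2\<^sub>j + x\<^sub>2\<^sub>j\<^sub>+\<^sub>1) ^ k\<close> over \<open>j \<le> 2 ^ m\<close> is a signed sum of \<open>m\<close> \<open>k\<close>-th
  powers of \<open>f\<^sub>1, \<dots>, f\<^sub>m\<close>. By pigeonhole there are \<open>j \<noteq> j'\<close> such that for every \<open>i\<close> the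
  coefficients of the variables with indices \<open>2 j\<close> and \<open>2 j'\<close> in \<open>f\<^sub>i\<close> have the same parity. Then the pairs of
  indices \<open>(2 j, 2 j + 1)\<close> and \<open>(2 j', 2 j + 1)\<close> yield the same invariant of the sum modulo \<open>2 k\<close>,
  but these invariants are \<open>k\<close> and \<open>0\<close>.
\<close>

section \<open>Coefficients of products and powers\<close>

abbreviation lookup :: "('a \<Rightarrow>\<^sub>0 'b::zero) \<Rightarrow> 'a \<Rightarrow> 'b"
  where "lookup \<equiv> Poly_Mapping.lookup"

text \<open>For each \<open>l\<close>, cancellation leaves at most one \<open>q\<close> with
  \<open>k = l + q\<close>, so the convolution runs over the set \<open>D\<close> of divisors of the
  monomial \<open>k\<close>.\<close>

lemma lookup_mult_eq_sum:
  fixes f g :: "'a::cancel_comm_monoid_add \<Rightarrow>\<^sub>0 'b::semiring_0"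
  assumes fin: "finite D" and D: "\<And>l. l \<in> D \<longleftrightarrow> (\<exists>q. k = l + q)"
  shows "lookup (f * g) k = (\<Sum>l\<in>D. lookup f l * lookup g (k - l))"
proof -
  have inner: "(\<Sum>q. lookup g q when k = l + q) = (if l \<in> D then lookup g (k - l) else 0)" for l
  proof (cases "l \<in> D")
    case True
    then obtain q where q: "k = l + q" using D by blast
    have "(\<lambda>q'. lookup g q' when k = l + q') = (\<lambda>q'. lookup g q' when q' = q)"
      using q by (auto simp: fun_eq_iff when_def)
    then show ?thesis using True q by simp
  next
    case False
    then have none: "k \<noteq> l + q" for q using D by blast
    show ?thesis using False by (simp add: none)
  qed
  have "lookup (f * g) k = (\<Sum>l. lookup f l * (if l \<in> D then lookup g (k - l) else 0))"
    unfolding lookup_mult inner ..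
  also have "\<dots> = (\<Sum>l\<in>D. lookup f l * (if l \<in> D then lookup g (k - l) else 0))"
    by (rule Sum_any.expand_superset[OF fin]) auto
  also have "\<dots> = (\<Sum>l\<in>D. lookup f l * lookup g (k - l))"
    by (rule sum.cong) auto
  finally show ?thesis .
qed

section \<open>Divisors of the monomials 1, u and u v\<close>

definition var_exp :: "nat \<Rightarrow> nat \<Rightarrow>\<^sub>0 nat"
  where "var_exp u = Poly_Mapping.single u 1"

lemma lookup_var_exp: "lookup (var_exp u) i = (if i = u then 1 else 0)"
  by (simp add: var_exp_def lookup_single when_def)

lemma var_exp_inject [simp]: "var_exp u = var_exp v \<longleftrightarrow> u = v"
  using lookup_var_exp[of u u] lookup_var_exp[of v u] by (auto split: if_splits)

lemma var_exp_neq_0 [simp]: "var_exp u \<noteq> 0"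
  using lookup_var_exp[of u u] by auto

lemma var_exp_add_neq [simp]:
  "var_exp u + var_exp v \<noteq> 0" "var_exp u + var_exp v \<noteq> var_exp w"
proof -
  have "lookup (var_exp u + var_exp v) u \<noteq> 0"
    by (simp add: lookup_add lookup_var_exp)
  then show "var_exp u + var_exp v \<noteq> 0" by auto
  show "var_exp u + var_exp v \<noteq> var_exp w"
  proof
    assume eq: "var_exp u + var_exp v = var_exp w"
    have "(if i = u then 1 else 0) + (if i = v then 1 else 0) = (if i = w then 1 else (0::nat))" for i
      using arg_cong[OF eq, of "\<lambda>p. lookup p i"] by (simp only: lookup_add lookup_var_exp)
    \<comment> \<open>The value at \<open>u\<close> forces \<open>w = u\<close> and
      \<open>u \<noteq> v\<close>; the value at \<open>v\<close> forces
      \<open>w = v\<close>.\<close>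
    from this[of u] this[of v] show False by (auto split: if_splits)
  qed
qed

lemma add_eq_0_poly_mapping_nat_iff:
  fixes l q :: "'a \<Rightarrow>\<^sub>0 nat"
  shows "l + q = 0 \<longleftrightarrow> l = 0 \<and> q = 0"
  by (auto simp: poly_mapping_eq_iff plus_poly_mapping.rep_eq fun_eq_iff)

lemma var_exp_eq_addD:
  assumes eq: "var_exp u = l + q"
  shows "l \<in> {0, var_exp u}"
proof -
  have *: "lookup l i + lookup q i = (if i = u then 1 else 0)" for i
    using arg_cong[OF eq, of "\<lambda>p. lookup p i"] by (simp only: lookup_add lookup_var_exp)
  consider "lookup l u = 0" | "lookup l u = 1"
    using *[of u] by (auto simp: add_is_1)
  then show ?thesis
  proof cases
    case 1
    have "lookup l i = lookup 0 i" for i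
      using *[of i] 1 by (cases "i = u") simp_all
    then have "l = 0" by (rule poly_mapping_eqI)
    then show ?thesis by simp
  next
    case 2
    have "lookup l i = lookup (var_exp u) i" for i
      using *[of i] 2 by (cases "i = u") (simp_all add: lookup_var_exp)
    then have "l = var_exp u" by (rule poly_mapping_eqI)
    then show ?thesis by simp
  qed
qed

text \<open>The monomial is square-free: a divisor has exponent 0 or 1 at \<open>u\<close> and at
  \<open>v\<close>, and 0 elsewhere, which leaves four.\<close>

lemma var_exp_add_eq_addD:
  assumes uv: "u \<noteq> v" and eq: "var_exp u + var_exp v = l + q"
  shows "l \<in> {0, var_exp u, var_exp v, var_exp u + var_exp v}"
proof -
  have *: "lookup l i + lookup q i = (if i = u then 1 else 0) + (if i = v then 1 else 0)" for i
    using arg_cong[OF eq, of "\<lambda>p. lookup p i"] by (simp only: lookup_add lookup_var_exp)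
  have "lookup l u = 0 \<or> lookup l u = 1" "lookup l v = 0 \<or> lookup l v = 1"
    using *[of u] *[of v] uv by (auto simp: add_is_1)
  then consider "lookup l u = 0" "lookup l v = 0" | "lookup l u = 1" "lookup l v = 0"
    | "lookup l u = 0" "lookup l v = 1" | "lookup l u = 1" "lookup l v = 1" by (elim disjE)
  then show ?thesis
  proof cases
    case 1
    have "lookup l i = lookup 0 i" for i
      using *[of i] 1 uv by (cases "i = u"; cases "i = v") (simp_all add: lookup_add lookup_var_exp)
    then have "l = 0" by (rule poly_mapping_eqI)
    then show ?thesis by simp
  next
    case 2
    have "lookup l i = lookup (var_exp u) i" for i
      using *[of i] 2 uv by (cases "i = u"; cases "i = v") (simp_all add: lookup_add lookup_var_exp)
    then have "l = var_exp u" by (rule poly_mapping_eqI)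
    then show ?thesis by simp
  next
    case 3
    have "lookup l i = lookup (var_exp v) i" for i
      using *[of i] 3 uv by (cases "i = u"; cases "i = v") (simp_all add: lookup_add lookup_var_exp)
    then have "l = var_exp v" by (rule poly_mapping_eqI)
    then show ?thesis by simp
  next
    case 4
    have "lookup l i = lookup (var_exp u + var_exp v) i" for i
      using *[of i] 4 uv by (cases "i = u"; cases "i = v") (simp_all add: lookup_add lookup_var_exp)
    then have "l = var_exp u + var_exp v" by (rule poly_mapping_eqI)
    then show ?thesis by simp
  qed
qed

section \<open>Coefficients of 1, u and u v in products and powers\<close>

lemma lookup_mult_zero:
  fixes f g :: "('a \<Rightarrow>\<^sub>0 nat) \<Rightarrow>\<^sub>0 'b::semiring_0"
  shows "lookup (f * g) 0 = lookup f 0 * lookup g 0"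
proof -
  have "l \<in> {0} \<longleftrightarrow> (\<exists>q. 0 = l + q)" for l :: "'a \<Rightarrow>\<^sub>0 nat"
    by (metis add_eq_0_poly_mapping_nat_iff add_0 singleton_iff)
  from lookup_mult_eq_sum[OF _ this, of f g] show ?thesis by simp
qed

lemma lookup_mult_var_exp:
  fixes f g :: "(nat \<Rightarrow>\<^sub>0 nat) \<Rightarrow>\<^sub>0 'b::semiring_0"
  shows "lookup (f * g) (var_exp u) =
    lookup f 0 * lookup g (var_exp u) + lookup f (var_exp u) * lookup g 0"
proof -
  have D: "l \<in> {0, var_exp u} \<longleftrightarrow> (\<exists>q. var_exp u = l + q)" for l
    using var_exp_eq_addD[of u l] by (metis add_0 add_0_right insert_iff singletonD)
  have "lookup (f * g) (var_exp u) =
      (\<Sum>l\<in>{0, var_exp u}. lookup f l * lookup g (var_exp u - l))"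
    by (rule lookup_mult_eq_sum[OF _ D]) simp
  then show ?thesis by (simp add: var_exp_neq_0[symmetric])
qed

lemma lookup_mult_var_exp_add:
  fixes f g :: "(nat \<Rightarrow>\<^sub>0 nat) \<Rightarrow>\<^sub>0 'b::semiring_0"
  assumes "u \<noteq> v"
  shows "lookup (f * g) (var_exp u + var_exp v) =
    lookup f 0 * lookup g (var_exp u + var_exp v) + lookup f (var_exp u) * lookup g (var_exp v) +
    lookup f (var_exp v) * lookup g (var_exp u) + lookup f (var_exp u + var_exp v) * lookup g 0"
proof -
  let ?D = "{0, var_exp u, var_exp v, var_exp u + var_exp v}"
  have D: "l \<in> ?D \<longleftrightarrow> (\<exists>q. var_exp u + var_exp v = l + q)" for l
  proof
    assume "l \<in> ?D"
    then consider "l = 0" | "l = var_exp u" | "l = var_exp v" | "l = var_exp u + var_exp v" by blast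
    then show "\<exists>q. var_exp u + var_exp v = l + q"
      by cases (metis add_0, metis, metis add.commute, metis add_0_right)
  qed (use var_exp_add_eq_addD[OF assms] in blast)
  have "lookup (f * g) (var_exp u + var_exp v) =
      (\<Sum>l\<in>?D. lookup f l * lookup g (var_exp u + var_exp v - l))"
    by (rule lookup_mult_eq_sum[OF _ D]) simp
  then show ?thesis
    using assms
    by (simp add: var_exp_neq_0[symmetric] var_exp_add_neq[symmetric] add.assoc)
qed

lemma lookup_power_zero:
  fixes f :: "('a \<Rightarrow>\<^sub>0 nat) \<Rightarrow>\<^sub>0 'b::comm_semiring_1"
  shows "lookup (f ^ s) 0 = lookup f 0 ^ s"
  by (induction s) (simp_all add: lookup_mult_zero)

lemma lookup_power_var_exp:
  fixes f :: "(nat \<Rightarrow>\<^sub>0 nat) \<Rightarrow>\<^sub>0 int"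
  shows "lookup (f ^ Suc s) (var_exp u) = int (Suc s) * lookup f 0 ^ s * lookup f (var_exp u)"
proof (induction s)
  case (Suc s)
  have "lookup (f ^ Suc (Suc s)) (var_exp u) = lookup (f * f ^ Suc s) (var_exp u)" by simp
  also have "\<dots> = lookup f 0 * lookup (f ^ Suc s) (var_exp u) +
      lookup f (var_exp u) * lookup f 0 ^ Suc s"
    by (simp only: lookup_mult_var_exp lookup_power_zero)
  finally show ?case unfolding Suc.IH by (simp add: algebra_simps)
qed simp

text \<open>Either one factor supplies u v, or an ordered pair of factors supplies u and v; all
  others supply constants. The exponent \<open>s + 2\<close> avoids subtraction.\<close>

lemma lookup_power_var_exp_add:
  fixes f :: "(nat \<Rightarrow>\<^sub>0 nat) \<Rightarrow>\<^sub>0 int"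
  assumes "u \<noteq> v"
  shows "lookup (f ^ (s + 2)) (var_exp u + var_exp v) =
    int (s + 2) * lookup f 0 ^ (s + 1) * lookup f (var_exp u + var_exp v) +
    int (s + 2) * int (s + 1) * lookup f 0 ^ s * lookup f (var_exp u) * lookup f (var_exp v)"
proof (induction s)
  case 0
  then show ?case
    by (simp add: power2_eq_square lookup_mult_var_exp_add[OF assms] mult.commute)
next
  case (Suc s)
  have linear: "lookup (f ^ (s + 2)) (var_exp w) =
      int (s + 2) * lookup f 0 ^ (s + 1) * lookup f (var_exp w)" for w
    using lookup_power_var_exp[of f "s + 1"] by simp
  have "lookup (f ^ (Suc s + 2)) (var_exp u + var_exp v) =
      lookup (f * f ^ (s + 2)) (var_exp u + var_exp v)" by simp
  also have "\<dots> = lookup f 0 * lookup (f ^ (s + 2)) (var_exp u + var_exp v) +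
      lookup f (var_exp u) * (int (s + 2) * lookup f 0 ^ (s + 1) * lookup f (var_exp v)) +
      lookup f (var_exp v) * (int (s + 2) * lookup f 0 ^ (s + 1) * lookup f (var_exp u)) +
      lookup f (var_exp u + var_exp v) * lookup f 0 ^ (s + 2)"
    by (simp only: lookup_mult_var_exp_add[OF assms] lookup_power_zero linear)
  finally show ?case unfolding Suc.IH by (simp add: algebra_simps)
qed

section \<open>Lifting the Frobenius map\<close>

text \<open>
  The graph of the ring endomorphism that squares every variable; it lifts the Frobenius map of the
  polynomial ring modulo 2.
\<close>

inductive frob :: "('a::comm_monoid_add \<Rightarrow>\<^sub>0 'b::comm_ring_1) \<Rightarrow> ('a \<Rightarrow>\<^sub>0 'b) \<Rightarrow> bool"
  where
    single: "frob (Poly_Mapping.single m c) (Poly_Mapping.single (m + m) c)"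
  | add: "frob f g \<Longrightarrow> frob f' g' \<Longrightarrow> frob (f + f') (g + g')"

lemma frob_exists: "\<exists>g. frob f g"
proof (induction f rule: Poly_Mapping.update_induct)
  case const
  then show ?case using frob.single[of 0 0] by auto
next
  case (update f m c)
  then have "Poly_Mapping.update m c f = Poly_Mapping.single m c + f"
    by (auto simp: poly_mapping_eq_iff fun_eq_iff lookup_update lookup_add lookup_single
        in_keys_iff)
  moreover obtain g where "frob f g" using update.IH by blast
  ultimately show ?case using frob.add[OF frob.single] by metis
qed

lemma frob_mult:
  assumes "frob f g" "frob f' g'"
  shows "frob (f * f') (g * g')"
  using assms(1)
proof (induction rule: frob.induct)
  case (single m c)
  show ?case using assms(2)
  proof (induction rule: frob.induct)
    case (single m' c')
    then show ?case
      using frob.single[of "m + m'" "c * c'"] by (simp add: mult_single algebra_simps)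
  next
    case (add f g f' g')
    then show ?case by (simp add: distrib_left frob.add)
  qed
next
  case (add f g f' g')
  then show ?case by (simp add: distrib_right frob.add)
qed

lemma frob_power:
  assumes "frob f g"
  shows "frob (f ^ s) (g ^ s)"
proof (induction s)
  case 0
  then show ?case using frob.single[of 0 1] by simp
next
  case (Suc s)
  then show ?case using frob_mult[OF assms] by simp
qed

lemma double_eq_iff:
  fixes l m :: "'a \<Rightarrow>\<^sub>0 nat"
  shows "l + l = m + m \<longleftrightarrow> l = m"
proof
  assume eq: "l + l = m + m"
  have "lookup l i = lookup m i" for i
    using arg_cong[OF eq, of "\<lambda>p. lookup p i"] by (simp add: lookup_add)
  then show "l = m" by (simp add: poly_mapping_eq_iff fun_eq_iff)
qed simp

text \<open>Doubling exponents is injective, so distinct monomials do not collide at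
  \<open>m + m\<close>.\<close>

lemma lookup_frob:
  fixes f g :: "('a \<Rightarrow>\<^sub>0 nat) \<Rightarrow>\<^sub>0 'b::comm_ring_1"
  assumes "frob f g"
  shows "lookup g (m + m) = lookup f m"
  using assms
proof (induction rule: frob.induct)
  case (single m' c)
  then show ?case by (simp add: lookup_single double_eq_iff)
next
  case (add f g f' g')
  then show ?case by (simp add: lookup_add)
qed

text \<open>Integers satisfy c^2 \<equiv> c modulo 2, and the cross term in the square of a sum is
  even.\<close>

lemma frob_square:
  fixes f g :: "'a::comm_monoid_add \<Rightarrow>\<^sub>0 int"
  assumes "frob f g"
  shows "\<exists>h. f ^ 2 = g + 2 * h"
  using assms
proof (induction rule: frob.induct)
  case (single m c)
  have "even (c * c - c)" by simp
  then obtain d where "c * c - c = 2 * d" by (rule evenE)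
  then have d: "c * c = c + (d + d)" by simp
  have "Poly_Mapping.single m c ^ 2 =
      Poly_Mapping.single (m + m) c + 2 * Poly_Mapping.single (m + m) d"
    by (simp only: power2_eq_square mult_single d single_add mult_2)
  then show ?case by blast
next
  case (add f g f' g')
  then obtain h h' where "f ^ 2 = g + 2 * h" "f' ^ 2 = g' + 2 * h'" by blast
  then have "(f + f') ^ 2 = (g + g') + 2 * (h + h' + f * f')"
    by (simp add: power2_sum algebra_simps)
  then show ?case by blast
qed

text \<open>From f^2 = g + 2 h, the squares f^4 and g^2 agree modulo 4. Raising to the power s / 2
  gives f^(2 s) \<equiv> g^s modulo 4, and g^s is the Frobenius lift of f^s.\<close>

lemma lookup_power_double_cong:
  fixes f :: "('a \<Rightarrow>\<^sub>0 nat) \<Rightarrow>\<^sub>0 int"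
  assumes "even s"
  shows "4 dvd lookup (f ^ (2 * s)) (m + m) - lookup (f ^ s) m"
proof -
  obtain g where g: "frob f g" using frob_exists by blast
  obtain h where h: "f ^ 2 = g + 2 * h" using frob_square[OF g] by blast
  obtain t where t: "s = 2 * t" using assms by blast
  have "(f ^ 2) ^ 2 - g ^ 2 = 4 * (g * h + h ^ 2)"
    unfolding h by (simp add: power2_sum algebra_simps power2_eq_square)
  then have "4 dvd (f ^ 2) ^ 2 - g ^ 2" by simp
  moreover have "(f ^ 2) ^ 2 - g ^ 2 dvd ((f ^ 2) ^ 2) ^ t - (g ^ 2) ^ t"
    by (simp add: power_diff_sumr2[of _ t])
  ultimately have "4 dvd ((f ^ 2) ^ 2) ^ t - (g ^ 2) ^ t"
    by (rule dvd_trans)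
  then have "4 dvd f ^ (2 * s) - g ^ s"
    by (simp add: t flip: power_mult)
  then obtain r where "f ^ (2 * s) - g ^ s = 4 * r" by (rule dvdE)
  then have r: "f ^ (2 * s) = g ^ s + 4 * r" by (simp add: algebra_simps)
  have "4 * r = r + r + r + r" by simp
  then have "lookup (4 * r) (m + m) = 4 * lookup r (m + m)"
    by (simp only: lookup_add)
  then show ?thesis
    unfolding r using lookup_frob[OF frob_power[OF g]] by (simp add: lookup_add)
qed

text \<open>The iterated doubling is the monomial m^(2^r). Each step doubles the exponent 2^(r+1),
  which is even, so the previous congruence applies down to f^2.\<close>

lemma lookup_power_two_cong:
  fixes f :: "('a \<Rightarrow>\<^sub>0 nat) \<Rightarrow>\<^sub>0 int"
  shows "4 dvd lookup (f ^ 2 ^ Suc r) (((\<lambda>m. m + m) ^^ r) m) - lookup (f ^ 2) m"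
proof (induction r)
  case (Suc r)
  let ?x = "((\<lambda>m. m + m) ^^ r) m"
  have trans: "4 dvd x - z" if "4 dvd x - y" "4 dvd y - z" for x y z :: int
    using dvd_add[OF that] by simp
  have "4 dvd lookup (f ^ (2 * 2 ^ Suc r)) (?x + ?x) - lookup (f ^ 2 ^ Suc r) ?x"
    by (rule lookup_power_double_cong) simp
  from trans[OF this Suc.IH] show ?case by (simp only: power_Suc funpow.simps o_apply)
qed simp

section \<open>The invariant of a pair of variables\<close>

text \<open>The second monomial is (u v)^(2^(n-1)). The weight 2^(n-1) turns its congruence modulo 4
  into one modulo 2^(n+1).\<close>

definition pair_inv :: "nat \<Rightarrow> nat \<Rightarrow> nat \<Rightarrow> ((nat \<Rightarrow>\<^sub>0 nat) \<Rightarrow>\<^sub>0 int) \<Rightarrow> int"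
  where "pair_inv n u v h = lookup h (var_exp u + var_exp v) +
    2 ^ (n - 1) * lookup h (((\<lambda>m. m + m) ^^ (n - 1)) (var_exp u + var_exp v))"

lemma pair_inv_0 [simp]: "pair_inv n u v 0 = 0"
  by (simp add: pair_inv_def)

lemma pair_inv_add: "pair_inv n u v (h + h') = pair_inv n u v h + pair_inv n u v h'"
  by (simp add: pair_inv_def lookup_add algebra_simps)

lemma pair_inv_uminus: "pair_inv n u v (- h) = - pair_inv n u v h"
  by (simp add: pair_inv_def)

lemma pair_inv_power:
  assumes "n \<ge> 2" "u \<noteq> v"
  shows "2 ^ Suc n dvd pair_inv n u v (f ^ 2 ^ n) -
    2 ^ n * ((1 + lookup f 0) * lookup f (var_exp u) * lookup f (var_exp v))"
proof -
  define a c d q where "a = lookup f 0" and "c = lookup f (var_exp u)"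
    and "d = lookup f (var_exp v)" and "q = lookup f (var_exp u + var_exp v)"
  obtain r where r: "n = Suc r" using assms by (cases n) auto
  then have r': "n - 1 = r" and pow_n: "(2::int) ^ n = 2 * 2 ^ r" by simp_all
  have "(2::nat) ^ 2 \<le> 2 ^ n" using assms by (intro power_increasing) auto
  then have "(2::nat) ^ n = (2 ^ n - 2) + 2" by simp
  then obtain s where s: "(2::nat) ^ n = s + 2" by blast
  \<comment> \<open>Positivity of \<open>s\<close> is where \<open>n \<ge> 2\<close> enters: it
    gives a^s \<equiv> a modulo 2 also for even \<open>a\<close>.\<close>
  with \<open>2 ^ 2 \<le> 2 ^ n\<close> have "s > 0" by simp
  have "even ((2::nat) ^ n)" using assms by simp
  then have "even s" unfolding s by simp
  have s': "int (s + 2) = 2 ^ n" by (metis s of_nat_numeral of_nat_power)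
  have f1: "lookup (f ^ 2 ^ n) (var_exp u + var_exp v) =
      2 ^ n * (a ^ (s + 1) * q + (int s + 1) * a ^ s * c * d)"
    unfolding s lookup_power_var_exp_add[OF assms(2)] s' a_def c_def d_def q_def
    by (simp add: algebra_simps)
  have "lookup (f ^ 2) (var_exp u + var_exp v) = 2 * (a * q + c * d)"
    using lookup_power_var_exp_add[OF assms(2), of f 0]
    unfolding add_0 by (simp add: a_def c_def d_def q_def mult.assoc)
  moreover obtain z where "lookup (f ^ 2 ^ n) (((\<lambda>m. m + m) ^^ r) (var_exp u + var_exp v)) -
      lookup (f ^ 2) (var_exp u + var_exp v) = 4 * z"
    using lookup_power_two_cong[of f r "var_exp u + var_exp v"] unfolding r by (rule dvdE)
  ultimately have f2: "lookup (f ^ 2 ^ n) (((\<lambda>m. m + m) ^^ r) (var_exp u + var_exp v)) =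
      2 * (a * q + c * d) + 4 * z"
    by linarith
  \<comment> \<open>Here \<open>E\<close> is the difference divided by 2^n. Modulo 2, a^(s+1) and
    a^s both reduce to a and s + 1 to 1, so the \<open>q\<close> terms cancel, and so do the
    \<open>c * d\<close> terms.\<close>
  define E where "E = a ^ (s + 1) * q + (int s + 1) * a ^ s * c * d + a * q - a * c * d + 2 * z"
  have eq: "pair_inv n u v (f ^ 2 ^ n) - 2 ^ n * ((1 + a) * c * d) = 2 ^ n * E"
    unfolding pair_inv_def f1 r' f2 E_def by (simp add: pow_n algebra_simps)
  have "even E"
    unfolding E_def using \<open>even s\<close> \<open>s > 0\<close> by (cases "even a"; cases "even q") simp_all
  then have "2 ^ Suc n dvd pair_inv n u v (f ^ 2 ^ n) - 2 ^ n * ((1 + a) * c * d)"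
    unfolding eq power_Suc2 by (rule mult_dvd_mono[OF dvd_refl])
  then show ?thesis unfolding a_def c_def d_def .
qed

text \<open>The signs disappear: negating a summand alters its contribution 2^n p by 2^(n+1) p,
  which vanishes modulo 2^(n+1).\<close>

lemma pair_inv_signed_sum:
  assumes "n \<ge> 2" "u \<noteq> v" "finite A" "\<And>i. i \<in> A \<Longrightarrow> e i = 1 \<or> e i = -1"
  shows "2 ^ Suc n dvd pair_inv n u v (\<Sum>i\<in>A. e i * g i ^ 2 ^ n) -
    2 ^ n * (\<Sum>i\<in>A. (1 + lookup (g i) 0) * lookup (g i) (var_exp u) * lookup (g i) (var_exp v))"
  using assms(3,4)
proof (induction rule: finite_induct)
  case (insert i A)
  define p where
    "p j = (1 + lookup (g j) 0) * lookup (g j) (var_exp u) * lookup (g j) (var_exp v)" for j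
  have dvd: "2 ^ Suc n dvd pair_inv n u v (g i ^ 2 ^ n) - 2 ^ n * p i"
    unfolding p_def by (rule pair_inv_power[OF assms(1,2)])
  consider "e i = 1" | "e i = - 1" using insert.prems by blast
  then have "2 ^ Suc n dvd pair_inv n u v (e i * g i ^ 2 ^ n) - 2 ^ n * p i"
  proof cases
    case 1
    with dvd show ?thesis by simp
  next
    case 2
    have "2 ^ Suc n dvd - (pair_inv n u v (g i ^ 2 ^ n) - 2 ^ n * p i) - 2 ^ Suc n * p i"
      using dvd by (intro dvd_diff) (simp_all only: dvd_minus_iff dvd_triv_left)
    also have "\<dots> = pair_inv n u v (e i * g i ^ 2 ^ n) - 2 ^ n * p i"
      using 2 by (simp add: pair_inv_uminus)
    finally show ?thesis .
  qed
  moreover have "2 ^ Suc n dvd pair_inv n u v (\<Sum>i\<in>A. e i * g i ^ 2 ^ n) - 2 ^ n * sum p A"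
    unfolding p_def using insert by simp
  ultimately have "2 ^ Suc n dvd (pair_inv n u v (e i * g i ^ 2 ^ n) - 2 ^ n * p i) +
      (pair_inv n u v (\<Sum>i\<in>A. e i * g i ^ 2 ^ n) - 2 ^ n * sum p A)"
    by (rule dvd_add)
  also have "\<dots> = pair_inv n u v (\<Sum>i\<in>insert i A. e i * g i ^ 2 ^ n) - 2 ^ n * sum p (insert i A)"
    using insert.hyps by (simp add: pair_inv_add distrib_left)
  finally show ?case unfolding p_def .
qed simp

section \<open>Sums of powers of binomials\<close>

text \<open>Different \<open>j\<close> use disjoint pairs of variables; the pair of the variable
  \<open>w\<close> is \<open>w div 2\<close>.\<close>

definition pair_sum :: "nat \<Rightarrow> (nat \<Rightarrow>\<^sub>0 nat) \<Rightarrow>\<^sub>0 int"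
  where "pair_sum j =
    Poly_Mapping.single (var_exp (2 * j)) 1 + Poly_Mapping.single (var_exp (2 * j + 1)) 1"

lemma lookup_pair_sum_0: "lookup (pair_sum j) 0 = 0"
  by (simp add: pair_sum_def lookup_add lookup_single)

lemma lookup_pair_sum_var_exp:
  "lookup (pair_sum j) (var_exp w) = (if w div 2 = j then 1 else 0)"
proof -
  have "w div 2 = j \<longleftrightarrow> w = 2 * j \<or> w = 2 * j + 1" by auto
  then show ?thesis by (auto simp: pair_sum_def lookup_add lookup_single when_def)
qed

lemma pair_sum_powers_not_signed_sum:
  fixes g e :: "nat \<Rightarrow> (nat \<Rightarrow>\<^sub>0 nat) \<Rightarrow>\<^sub>0 int"
  assumes n: "n \<ge> 2" and e: "\<And>i. i \<in> {1..m} \<Longrightarrow> e i = 1 \<or> e i = -1"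
  shows "(\<Sum>j\<le>2 ^ m. pair_sum j ^ 2 ^ n) \<noteq> (\<Sum>i=1..m. e i * g i ^ 2 ^ n)"
proof
  let ?N = "{..(2::nat) ^ m}"
  assume eq: "(\<Sum>j\<in>?N. pair_sum j ^ 2 ^ n) = (\<Sum>i=1..m. e i * g i ^ 2 ^ n)"
  define b where "b i w = lookup (g i) (var_exp w)" for i w
  define a where "a i = 1 + lookup (g i) 0" for i
  define t where "t u v = (\<Sum>j\<in>?N. if u div 2 = j \<and> v div 2 = j then 1 else (0::int))" for u v
  \<comment> \<open>Off the diagonal, the 0-1 matrix \<open>t\<close> of indices in a common pair is
    modulo 2 a sum of \<open>m\<close> matrices of rank at most one.\<close>
  have parity: "even ((\<Sum>i=1..m. a i * b i u * b i v) - t u v)" if "u \<noteq> v" for u v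
  proof -
    \<comment> \<open>The factor 1 presents the left-hand sum as a signed sum, so one lemma
      evaluates both sides.\<close>
    have "2 ^ Suc n dvd pair_inv n u v (\<Sum>j\<in>?N. 1 * pair_sum j ^ 2 ^ n) - 2 ^ n * (\<Sum>j\<in>?N.
        (1 + lookup (pair_sum j) 0) * lookup (pair_sum j) (var_exp u) * lookup (pair_sum j) (var_exp v))"
      using n that by (intro pair_inv_signed_sum) auto
    also have "(\<Sum>j\<in>?N. (1 + lookup (pair_sum j) 0) * lookup (pair_sum j) (var_exp u) *
        lookup (pair_sum j) (var_exp v)) = t u v"
      unfolding t_def by (intro sum.cong) (auto simp: lookup_pair_sum_0 lookup_pair_sum_var_exp)
    finally have 1: "2 ^ Suc n dvd pair_inv n u v (\<Sum>i=1..m. e i * g i ^ 2 ^ n) - 2 ^ n * t u v"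
      using eq by simp
    have 2: "2 ^ Suc n dvd pair_inv n u v (\<Sum>i=1..m. e i * g i ^ 2 ^ n) -
        2 ^ n * (\<Sum>i=1..m. a i * b i u * b i v)"
      unfolding a_def b_def using e by (intro pair_inv_signed_sum[OF n that]) auto
    have "2 ^ n * 2 dvd 2 ^ n * ((\<Sum>i=1..m. a i * b i u * b i v) - t u v)"
      using dvd_diff[OF 1 2] by (simp add: algebra_simps)
    then show ?thesis by simp
  qed
  \<comment> \<open>\<open>P j\<close> records the parities at the variable \<open>2 * j\<close>.
    There are at most 2^m such subsets, but 2^m + 1 indices, as 0 is included.\<close>
  define P where "P j = {i \<in> {1..m}. odd (b i (2 * j))}" for j
  have "card (P ` ?N) \<le> card (Pow {1..m})"
    by (rule card_mono) (auto simp: P_def)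
  also have "\<dots> < card ?N" by (simp add: card_Pow)
  finally have "\<not> inj_on P ?N" by (rule pigeonhole)
  then obtain j j' where j: "j \<in> ?N" "j' \<in> ?N" "j \<noteq> j'" "P j = P j'"
    by (auto simp: inj_on_def)
  have parity_trans: "even (t - t')" if "even (x - y)" "even (x - t)" "even (y - t')"
    for x y t t' :: int
    using that by simp
  have "even (b i (2 * j) - b i (2 * j'))" if "i \<in> {1..m}" for i
    using j(4) that unfolding P_def set_eq_iff by auto
  then have "even (\<Sum>i=1..m. a i * (b i (2 * j) - b i (2 * j')) * b i (2 * j + 1))"
    by (intro dvd_sum) auto
  also have "(\<Sum>i=1..m. a i * (b i (2 * j) - b i (2 * j')) * b i (2 * j + 1)) =
      (\<Sum>i=1..m. a i * b i (2 * j) * b i (2 * j + 1)) -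
      (\<Sum>i=1..m. a i * b i (2 * j') * b i (2 * j + 1))"
    by (simp add: sum_subtractf algebra_simps)
  finally have "even (t (2 * j) (2 * j + 1) - t (2 * j') (2 * j + 1))"
    \<comment> \<open>The index pairs are off the diagonal, since an even number differs from
      \<open>2 * j + 1\<close>.\<close>
    by (rule parity_trans) (rule parity, presburger)+
  moreover have "t (2 * j) (2 * j + 1) = 1" using j(1) by (simp add: t_def)
  moreover have "t (2 * j') (2 * j + 1) = 0"
    unfolding t_def using j(3) by (intro sum.neutral) auto
  ultimately show False by simp
qed

section \<open>Translation to the ring structure\<close>

lemma cring_R_inf: "cring R_inf"
  unfolding R_inf_def by (rule cring_from_type_algebra)

lemma R_inf_simps:
  "carrier R_inf = UNIV" "x \<otimes>\<^bsub>R_inf\<^esub> y = x * y" "x \<oplus>\<^bsub>R_inf\<^esub> y = x + y"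
  "\<one>\<^bsub>R_inf\<^esub> = 1" "\<zero>\<^bsub>R_inf\<^esub> = 0"
  by (simp_all add: R_inf_def ring_of_type_algebra_def)

lemma R_inf_uminus: "\<ominus>\<^bsub>R_inf\<^esub> x = - x"
proof -
  interpret cring R_inf by (rule cring_R_inf)
  show ?thesis by (rule minus_equality) (simp_all add: R_inf_simps)
qed

lemma R_inf_pow: "x [^]\<^bsub>R_inf\<^esub> (k::nat) = x ^ k"
proof -
  interpret cring R_inf by (rule cring_R_inf)
  show ?thesis by (induction k) (simp_all add: R_inf_simps mult.commute)
qed

lemma R_inf_finsum:
  assumes "finite S"
  shows "(\<Oplus>\<^bsub>R_inf\<^esub>i\<in>S. h i) = sum h S"
proof -
  interpret cring R_inf by (rule cring_R_inf)
  show ?thesis using assms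
    by (induction rule: finite_induct) (simp_all add: R_inf_simps)
qed

lemma sum_powers_in_power_ring_R_inf: "(\<Sum>j\<in>S. h j ^ k) \<in> power_ring k R_inf"
proof -
  let ?H = "{a [^]\<^bsub>R_inf\<^esub> k | a. a \<in> carrier R_inf}"
  have "x + y \<in> power_ring k R_inf" if "x \<in> power_ring k R_inf" "y \<in> power_ring k R_inf" for x y
    using generate_ring.eng_add[of x R_inf ?H y] that
    by (simp add: power_ring_def R_inf_simps)
  moreover have "x ^ k \<in> power_ring k R_inf" for x
    unfolding power_ring_def by (rule generate_ring.incl) (auto simp: R_inf_simps R_inf_pow)
  \<comment> \<open>Zero arises as 1 + (-1); it is the value of the empty sum, and of the sum over
    an infinite \<open>S\<close>.\<close>
  moreover have "0 \<in> power_ring k R_inf"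
    using generate_ring.eng_add[OF generate_ring.one[of R_inf ?H]
        generate_ring.a_inv[OF generate_ring.one[of R_inf ?H]]]
    by (simp add: power_ring_def R_inf_simps R_inf_uminus)
  ultimately show ?thesis
    by (induction S rule: infinite_finite_induct) auto
qed

lemma not_waring_bound_R_inf:
  assumes "n \<ge> 2"
  shows "\<not> waring_bound (2 ^ n) R_inf m"
proof
  assume "waring_bound (2 ^ n) R_inf m"
  then have "signed_power_sum (2 ^ n) R_inf m (\<Sum>j\<le>2 ^ m. pair_sum j ^ 2 ^ n)"
    unfolding waring_bound_def using sum_powers_in_power_ring_R_inf by blast
  then obtain g e where e: "e \<in> {1..m} \<rightarrow> {1, -1}"
    and eq: "(\<Sum>j\<le>2 ^ m. pair_sum j ^ 2 ^ n) = (\<Sum>i=1..m. e i * g i ^ 2 ^ n)"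
    unfolding signed_power_sum_def
    by (auto simp: R_inf_simps R_inf_uminus R_inf_pow R_inf_finsum)
  have "e i = 1 \<or> e i = -1" if "i \<in> {1..m}" for i
    using e that by auto
  from pair_sum_powers_not_signed_sum[OF assms this] eq show False
    by (rule notE)
qed

theorem theorem1p1:
  fixes n :: nat
  assumes "n \<ge> 2"
    and "infinite (UNIV :: 'u set)"
  shows "waring_V TYPE('u) (2 ^ n) = waring_v (2 ^ n) R_inf \<and> waring_v (2 ^ n) R_inf = \<infinity>"
proof -
  have "waring_v (2 ^ n) R_inf = \<infinity>"
    using not_waring_bound_R_inf[OF assms(1)] by (simp add: waring_v_def)
  \<comment> \<open>The supremum over rings carried by \<open>'u\<close> dominates
    \<open>waring_v\<close> of every commutative ring, including \<open>R_inf\<close>, whose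
    elements have another type.\<close>
  moreover from this have "waring_V TYPE('u) (2 ^ n) = \<infinity>"
    using waring_v_le_waring_V[OF cring_R_inf _ assms(2), of "2 ^ n"] by simp
  ultimately show ?thesis by simp
qed

end
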